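(* Let $\mathcal{C}$ be a skeletally small extriangulated category, $\mathcal{S}$ a Serre subcategory of $\mathcal{C}$ and $\iota\colon\mathcal{S}\to\mathcal{C}$ the inclusion functor. Then the monoid homomorphism $\mathsf{M}(\iota)\colon\mathsf{M}(\mathcal{S})\to\mathsf{M}(\mathcal{C})$, $[X]\mapsto[X]$, is injective. In particular, it induces an isomorphism of monoids from $\mathsf{M}(\mathcal{S})$ onto $\mathsf{M}_{\mathcal{S}}:=\{[X]\in\mathsf{M}(\mathcal{C})\mid X\in\mathcal{S}\}\subseteq\mathsf{M}(\mathcal{C})$.
   Context: Extriangulated categories $(\mathcal{C},\mathbb{E},\mathfrak{s})$ are in the sense of Nakaoka--Palu; a conflation $X\to Y\to Z\dashrightarrow$ is a sequence realizing some $\delta\in\mathbb{E}(Z,X)$. Subcategories are full and closed under isomorphisms. A Serre subcategory is an additive subcategory $\mathcal{S}$ such that for each conflation $X\to Y\to Z\dashrightarrow$ in $\mathcal{C}$, $Y\in\mathcal{S}$ if and only if $X,Z\in\mathcal{S}$. It is extension-closed, and is regarded as an extriangulated category whose conflations are the conflations of $\mathcal{C}$ with all three terms in $\mathcal{S}$. All monoids are commutative. The Grothendieck monoid $\mathsf{M}(\mathcal{C})$ is the monoid with a map $X\mapsto[X]$ from the set of isomorphism classes of objects, universal among maps $f$ to monoids with $f[0]=0$ and $f[Y]=f[X]+f[Z]$ for every conflation $X\to Y\to Z\dashrightarrow$. *)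

theory Defs
  imports "HOL-Library.Multiset" "HOL-Algebra.Group"
begin

section \<open>Additive categories\<close>

text \<open>
  A (pre)additive category is given by a set of objects, an abelian group of morphisms for each
  pair of objects (written multiplicatively, as all groups of the library are), identities and
  composition. Composition does not take the objects as arguments. This is no restriction,
  since morphisms can always be tagged with their domain and codomain.
\<close>

record ('o, 'm) preadd_cat =
  Ob :: "'o set"
  Hom :: "'o \<Rightarrow> 'o \<Rightarrow> 'm monoid"
  Id :: "'o \<Rightarrow> 'm"
  Cmp :: "'m \<Rightarrow> 'm \<Rightarrow> 'm" (infixl "\<cdot>\<index>" 70)

abbreviation arr :: "('o, 'm, 'z) preadd_cat_scheme \<Rightarrow> 'o \<Rightarrow> 'o \<Rightarrow> 'm set"
  where "arr C A B \<equiv> carrier (Hom C A B)"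

abbreviation zero_arr :: "('o, 'm, 'z) preadd_cat_scheme \<Rightarrow> 'o \<Rightarrow> 'o \<Rightarrow> 'm"
  where "zero_arr C A B \<equiv> one (Hom C A B)"

abbreviation add_arr :: "('o, 'm, 'z) preadd_cat_scheme \<Rightarrow> 'o \<Rightarrow> 'o \<Rightarrow> 'm \<Rightarrow> 'm \<Rightarrow> 'm"
  where "add_arr C A B \<equiv> monoid.mult (Hom C A B)"

locale preadditive_category =
  fixes C (structure)
  assumes Hom_comm_group: "\<lbrakk>A \<in> Ob C; B \<in> Ob C\<rbrakk> \<Longrightarrow> comm_group (Hom C A B)"
    and Id_closed: "A \<in> Ob C \<Longrightarrow> Id C A \<in> arr C A A"
    and Cmp_closed:
      "\<lbrakk>A \<in> Ob C; B \<in> Ob C; D \<in> Ob C; f \<in> arr C A B; g \<in> arr C B D\<rbrakk> \<Longrightarrow> g \<cdot> f \<in> arr C A D"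
    and Cmp_assoc:
      "\<lbrakk>A \<in> Ob C; B \<in> Ob C; D \<in> Ob C; E \<in> Ob C; f \<in> arr C A B; g \<in> arr C B D; h \<in> arr C D E\<rbrakk>
        \<Longrightarrow> (h \<cdot> g) \<cdot> f = h \<cdot> (g \<cdot> f)"
    and Cmp_Id_left: "\<lbrakk>A \<in> Ob C; B \<in> Ob C; f \<in> arr C A B\<rbrakk> \<Longrightarrow> Id C B \<cdot> f = f"
    and Cmp_Id_right: "\<lbrakk>A \<in> Ob C; B \<in> Ob C; f \<in> arr C A B\<rbrakk> \<Longrightarrow> f \<cdot> Id C A = f"
    and Cmp_additive_left:
      "\<lbrakk>A \<in> Ob C; B \<in> Ob C; D \<in> Ob C; f \<in> arr C A B\<rbrakk>
        \<Longrightarrow> (\<lambda>g. g \<cdot> f) \<in> hom (Hom C B D) (Hom C A D)"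
    and Cmp_additive_right:
      "\<lbrakk>A \<in> Ob C; B \<in> Ob C; D \<in> Ob C; g \<in> arr C B D\<rbrakk>
        \<Longrightarrow> (\<lambda>f. g \<cdot> f) \<in> hom (Hom C A B) (Hom C A D)"

definition iso_arr :: "('o, 'm, 'z) preadd_cat_scheme \<Rightarrow> 'o \<Rightarrow> 'o \<Rightarrow> 'm \<Rightarrow> bool"
  where "iso_arr C A B f \<longleftrightarrow> A \<in> Ob C \<and> B \<in> Ob C \<and> f \<in> arr C A B \<and>
    (\<exists>g \<in> arr C B A. g \<cdot>\<^bsub>C\<^esub> f = Id C A \<and> f \<cdot>\<^bsub>C\<^esub> g = Id C B)"

definition isomorphic :: "('o, 'm, 'z) preadd_cat_scheme \<Rightarrow> 'o \<Rightarrow> 'o \<Rightarrow> bool"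
  where "isomorphic C A B \<longleftrightarrow> (\<exists>f. iso_arr C A B f)"

definition zero_object :: "('o, 'm, 'z) preadd_cat_scheme \<Rightarrow> 'o \<Rightarrow> bool"
  where "zero_object C Z \<longleftrightarrow> Z \<in> Ob C \<and>
    (\<forall>A \<in> Ob C. (\<exists>!f. f \<in> arr C A Z) \<and> (\<exists>!f. f \<in> arr C Z A))"

definition biproduct ::
    "('o, 'm, 'z) preadd_cat_scheme \<Rightarrow> 'o \<Rightarrow> 'o \<Rightarrow> 'o \<Rightarrow> 'm \<Rightarrow> 'm \<Rightarrow> 'm \<Rightarrow> 'm \<Rightarrow> bool"
  where "biproduct C A B P i j p q \<longleftrightarrow> A \<in> Ob C \<and> B \<in> Ob C \<and> P \<in> Ob C \<and>
    i \<in> arr C A P \<and> j \<in> arr C B P \<and> p \<in> arr C P A \<and> q \<in> arr C P B \<and>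
    p \<cdot>\<^bsub>C\<^esub> i = Id C A \<and> q \<cdot>\<^bsub>C\<^esub> j = Id C B \<and> q \<cdot>\<^bsub>C\<^esub> i = zero_arr C A B \<and> p \<cdot>\<^bsub>C\<^esub> j = zero_arr C B A \<and>
    add_arr C P P (i \<cdot>\<^bsub>C\<^esub> p) (j \<cdot>\<^bsub>C\<^esub> q) = Id C P"

locale additive_category = preadditive_category +
  assumes ex_zero_object: "\<exists>Z. zero_object C Z"
    and ex_biproduct: "\<lbrakk>A \<in> Ob C; B \<in> Ob C\<rbrakk> \<Longrightarrow> \<exists>P i j p q. biproduct C A B P i j p q"

section \<open>Extriangulated categories\<close>

text \<open>
  \<open>Ext C Z X\<close> is the abelian group $\mathbb{E}(Z,X)$, with \<open>push C a\<close> for $a_*$ and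
  \<open>pull C c\<close> for $c^*$. The class \<open>rlz C Z X \<delta>\<close> is $\mathfrak{s}(\delta)$, a set of triples
  \<open>(Y, x, y)\<close> standing for the sequences $X \to Y \to Z$ with morphisms $x$ and $y$.
\<close>

record ('o, 'm, 'e) extri_cat = "('o, 'm) preadd_cat" +
  Ext :: "'o \<Rightarrow> 'o \<Rightarrow> 'e monoid"
  push :: "'m \<Rightarrow> 'e \<Rightarrow> 'e"
  pull :: "'m \<Rightarrow> 'e \<Rightarrow> 'e"
  rlz :: "'o \<Rightarrow> 'o \<Rightarrow> 'e \<Rightarrow> ('o \<times> 'm \<times> 'm) set"

abbreviation exts :: "('o, 'm, 'e, 'z) extri_cat_scheme \<Rightarrow> 'o \<Rightarrow> 'o \<Rightarrow> 'e set"
  where "exts C Z X \<equiv> carrier (Ext C Z X)"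

locale additive_bifunctor = additive_category +
  assumes Ext_comm_group: "\<lbrakk>Z \<in> Ob C; X \<in> Ob C\<rbrakk> \<Longrightarrow> comm_group (Ext C Z X)"
    and push_hom:
      "\<lbrakk>Z \<in> Ob C; X \<in> Ob C; X' \<in> Ob C; a \<in> arr C X X'\<rbrakk> \<Longrightarrow> push C a \<in> hom (Ext C Z X) (Ext C Z X')"
    and pull_hom:
      "\<lbrakk>Z \<in> Ob C; Z' \<in> Ob C; X \<in> Ob C; c \<in> arr C Z' Z\<rbrakk> \<Longrightarrow> pull C c \<in> hom (Ext C Z X) (Ext C Z' X)"
    and push_Id: "\<lbrakk>Z \<in> Ob C; X \<in> Ob C; \<delta> \<in> exts C Z X\<rbrakk> \<Longrightarrow> push C (Id C X) \<delta> = \<delta>"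
    and pull_Id: "\<lbrakk>Z \<in> Ob C; X \<in> Ob C; \<delta> \<in> exts C Z X\<rbrakk> \<Longrightarrow> pull C (Id C Z) \<delta> = \<delta>"
    and push_Cmp:
      "\<lbrakk>Z \<in> Ob C; X \<in> Ob C; X' \<in> Ob C; X'' \<in> Ob C; a \<in> arr C X X'; a' \<in> arr C X' X''; \<delta> \<in> exts C Z X\<rbrakk>
        \<Longrightarrow> push C (a' \<cdot> a) \<delta> = push C a' (push C a \<delta>)"
    and pull_Cmp:
      "\<lbrakk>Z \<in> Ob C; Z' \<in> Ob C; Z'' \<in> Ob C; X \<in> Ob C; c \<in> arr C Z' Z; c' \<in> arr C Z'' Z'; \<delta> \<in> exts C Z X\<rbrakk>
        \<Longrightarrow> pull C (c \<cdot> c') \<delta> = pull C c' (pull C c \<delta>)"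
    and push_pull:
      "\<lbrakk>Z \<in> Ob C; Z' \<in> Ob C; X \<in> Ob C; X' \<in> Ob C; a \<in> arr C X X'; c \<in> arr C Z' Z; \<delta> \<in> exts C Z X\<rbrakk>
        \<Longrightarrow> push C a (pull C c \<delta>) = pull C c (push C a \<delta>)"
    and push_additive:
      "\<lbrakk>Z \<in> Ob C; X \<in> Ob C; X' \<in> Ob C; \<delta> \<in> exts C Z X\<rbrakk>
        \<Longrightarrow> (\<lambda>a. push C a \<delta>) \<in> hom (Hom C X X') (Ext C Z X')"
    and pull_additive:
      "\<lbrakk>Z \<in> Ob C; Z' \<in> Ob C; X \<in> Ob C; \<delta> \<in> exts C Z X\<rbrakk>
        \<Longrightarrow> (\<lambda>c. pull C c \<delta>) \<in> hom (Hom C Z' Z) (Ext C Z' X)"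

definition seqs :: "('o, 'm, 'z) preadd_cat_scheme \<Rightarrow> 'o \<Rightarrow> 'o \<Rightarrow> ('o \<times> 'm \<times> 'm) set"
  where "seqs C Z X = {(Y, x, y). Y \<in> Ob C \<and> x \<in> arr C X Y \<and> y \<in> arr C Y Z}"

definition seq_equiv ::
    "('o, 'm, 'z) preadd_cat_scheme \<Rightarrow> 'o \<Rightarrow> 'o \<Rightarrow> (('o \<times> 'm \<times> 'm) \<times> ('o \<times> 'm \<times> 'm)) set"
  where "seq_equiv C Z X = {((Y, x, y), (Y', x', y')).
    (Y, x, y) \<in> seqs C Z X \<and> (Y', x', y') \<in> seqs C Z X \<and>
    (\<exists>b. iso_arr C Y Y' b \<and> b \<cdot>\<^bsub>C\<^esub> x = x' \<and> y' \<cdot>\<^bsub>C\<^esub> b = y)}"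

definition realized_by ::
    "('o, 'm, 'e, 'z) extri_cat_scheme \<Rightarrow> 'e \<Rightarrow> 'o \<Rightarrow> 'o \<Rightarrow> 'o \<Rightarrow> 'm \<Rightarrow> 'm \<Rightarrow> bool"
  where "realized_by C \<delta> X Y Z x y \<longleftrightarrow>
    X \<in> Ob C \<and> Y \<in> Ob C \<and> Z \<in> Ob C \<and> \<delta> \<in> exts C Z X \<and> (Y, x, y) \<in> rlz C Z X \<delta>"

definition conflation ::
    "('o, 'm, 'e, 'z) extri_cat_scheme \<Rightarrow> 'o \<Rightarrow> 'o \<Rightarrow> 'o \<Rightarrow> 'm \<Rightarrow> 'm \<Rightarrow> bool"
  where "conflation C X Y Z x y \<longleftrightarrow> (\<exists>\<delta>. realized_by C \<delta> X Y Z x y)"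

text \<open>
  Morphisms of extensions $\delta \to \delta'$, the direct sum of two morphisms
  and the direct sum of two extensions, the latter two with respect to given biproducts.
  As $\mathbb{E}$ is biadditive, $\delta\oplus\delta'$ is
  $i_* p^* \delta + j_* q^* \delta'$, the element corresponding to $(\delta,0,0,\delta')$.
\<close>

definition ext_morphism ::
    "('o, 'm, 'e, 'z) extri_cat_scheme \<Rightarrow> 'o \<Rightarrow> 'o \<Rightarrow> 'e \<Rightarrow> 'o \<Rightarrow> 'o \<Rightarrow> 'e \<Rightarrow> 'm \<Rightarrow> 'm \<Rightarrow> bool"
  where "ext_morphism C X Z \<delta> X' Z' \<delta>' a c \<longleftrightarrow>
    a \<in> arr C X X' \<and> c \<in> arr C Z Z' \<and> push C a \<delta> = pull C c \<delta>'"

definition sum_arr ::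
    "('o, 'm, 'z) preadd_cat_scheme \<Rightarrow> 'o \<Rightarrow> 'o \<Rightarrow> 'm \<Rightarrow> 'm \<Rightarrow> 'm \<Rightarrow> 'm \<Rightarrow> 'm \<Rightarrow> 'm \<Rightarrow> 'm"
  where "sum_arr C P Q p q i j f g = add_arr C P Q (i \<cdot>\<^bsub>C\<^esub> f \<cdot>\<^bsub>C\<^esub> p) (j \<cdot>\<^bsub>C\<^esub> g \<cdot>\<^bsub>C\<^esub> q)"

definition sum_ext ::
    "('o, 'm, 'e, 'z) extri_cat_scheme \<Rightarrow> 'o \<Rightarrow> 'o \<Rightarrow> 'm \<Rightarrow> 'm \<Rightarrow> 'm \<Rightarrow> 'm \<Rightarrow> 'e \<Rightarrow> 'e \<Rightarrow> 'e"
  where "sum_ext C P Q p q i j \<delta> \<delta>' =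
    push C i (pull C p \<delta>) \<otimes>\<^bsub>Ext C P Q\<^esub> push C j (pull C q \<delta>')"

locale additive_realization = additive_bifunctor +
  assumes rlz_class:
      "\<lbrakk>Z \<in> Ob C; X \<in> Ob C; \<delta> \<in> exts C Z X\<rbrakk> \<Longrightarrow> rlz C Z X \<delta> \<in> seqs C Z X // seq_equiv C Z X"
    and rlz_morphism:
      "\<lbrakk>realized_by C \<delta> X Y Z x y; realized_by C \<delta>' X' Y' Z' x' y';
        ext_morphism C X Z \<delta> X' Z' \<delta>' a c\<rbrakk>
        \<Longrightarrow> \<exists>b \<in> arr C Y Y'. b \<cdot> x = x' \<cdot> a \<and> y' \<cdot> b = c \<cdot> y"
    and rlz_zero:
      "biproduct C X Z P i j p q \<Longrightarrow> realized_by C \<one>\<^bsub>Ext C Z X\<^esub> X P Z i q"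
    and rlz_sum:
      "\<lbrakk>realized_by C \<delta> X Y Z x y; realized_by C \<delta>' X' Y' Z' x' y';
        biproduct C X X' PX iX jX pX qX;
        biproduct C Y Y' PY iY jY pY qY;
        biproduct C Z Z' PZ iZ jZ pZ qZ\<rbrakk>
        \<Longrightarrow> realized_by C (sum_ext C PZ PX pZ qZ iX jX \<delta> \<delta>') PX PY PZ
              (sum_arr C PX PY pX qX iY jY x x') (sum_arr C PY PZ pY qY iZ jZ y y')"

text \<open>
  The axioms (ET3), (ET4) and their duals. The diagrams of (ET4) and its dual are
  \begin{verbatim}
    A -f-> B -f'-> D            D -d--> E -e--> F
    |      |       |            |       |       |
    1      g       d            1       h'      g'
    v      v       v            v       v       v
    A -h-> M -h'-> E            D -f'-> A -f--> B
           |       |                    |       |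
           g'      e                    h       g
           v       v                    v       v
           F  ==   F                    M  ==   M
  \end{verbatim}
\<close>

locale extriangulated_category = additive_realization +
  assumes ET3:
      "\<lbrakk>realized_by C \<delta> X Y Z x y; realized_by C \<delta>' X' Y' Z' x' y';
        a \<in> arr C X X'; b \<in> arr C Y Y'; b \<cdot> x = x' \<cdot> a\<rbrakk>
        \<Longrightarrow> \<exists>c. ext_morphism C X Z \<delta> X' Z' \<delta>' a c \<and> c \<cdot> y = y' \<cdot> b"
    and ET3_op:
      "\<lbrakk>realized_by C \<delta> X Y Z x y; realized_by C \<delta>' X' Y' Z' x' y';
        b \<in> arr C Y Y'; c \<in> arr C Z Z'; c \<cdot> y = y' \<cdot> b\<rbrakk>
        \<Longrightarrow> \<exists>a. ext_morphism C X Z \<delta> X' Z' \<delta>' a c \<and> b \<cdot> x = x' \<cdot> a"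
    and ET4:
      "\<lbrakk>realized_by C \<delta> A B D f f'; realized_by C \<delta>' B M F g g'\<rbrakk>
        \<Longrightarrow> \<exists>E \<in> Ob C. \<exists>h \<in> arr C A M. \<exists>h' \<in> arr C M E. \<exists>d \<in> arr C D E. \<exists>e \<in> arr C E F.
              \<exists>\<delta>'' \<in> exts C E A.
              h = g \<cdot> f \<and> h' \<cdot> g = d \<cdot> f' \<and> e \<cdot> h' = g' \<and>
              realized_by C \<delta>'' A M E h h' \<and>
              realized_by C (push C f' \<delta>') D E F d e \<and>
              pull C d \<delta>'' = \<delta> \<and>
              push C f \<delta>'' = pull C e \<delta>'"
    and ET4_op:
      "\<lbrakk>realized_by C \<delta> D A B f' f; realized_by C \<delta>' F B M g' g\<rbrakk>
        \<Longrightarrow> \<exists>E \<in> Ob C. \<exists>h' \<in> arr C E A. \<exists>h \<in> arr C A M. \<exists>d \<in> arr C D E. \<exists>e \<in> arr C E F.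
              \<exists>\<delta>'' \<in> exts C M E.
              h = g \<cdot> f \<and> h' \<cdot> d = f' \<and> f \<cdot> h' = g' \<cdot> e \<and>
              realized_by C \<delta>'' E A M h' h \<and>
              realized_by C (pull C g' \<delta>) D E F d e \<and>
              \<delta>' = push C e \<delta>'' \<and>
              push C d \<delta> = pull C g \<delta>''"

section \<open>Serre subcategories\<close>

text \<open>A full subcategory is given by its set of objects.\<close>

definition iso_closed :: "('o, 'm, 'z) preadd_cat_scheme \<Rightarrow> 'o set \<Rightarrow> bool"
  where "iso_closed C S \<longleftrightarrow> S \<subseteq> Ob C \<and> (\<forall>X Y. X \<in> S \<and> isomorphic C X Y \<longrightarrow> Y \<in> S)"

definition additive_subcategory :: "('o, 'm, 'z) preadd_cat_scheme \<Rightarrow> 'o set \<Rightarrow> bool"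
  where "additive_subcategory C S \<longleftrightarrow> iso_closed C S \<and> (\<forall>Z. zero_object C Z \<longrightarrow> Z \<in> S) \<and>
    (\<forall>A \<in> S. \<forall>B \<in> S. \<forall>P i j p q. biproduct C A B P i j p q \<longrightarrow> P \<in> S)"

definition serre_subcategory :: "('o, 'm, 'e, 'z) extri_cat_scheme \<Rightarrow> 'o set \<Rightarrow> bool"
  where "serre_subcategory C S \<longleftrightarrow> additive_subcategory C S \<and>
    (\<forall>X Y Z x y. conflation C X Y Z x y \<longrightarrow> (Y \<in> S \<longleftrightarrow> X \<in> S \<and> Z \<in> S))"

definition subcat :: "('o, 'm, 'e) extri_cat \<Rightarrow> 'o set \<Rightarrow> ('o, 'm, 'e) extri_cat"
  where "subcat C S = C\<lparr>Ob := S, rlz := (\<lambda>Z X \<delta>. {(Y, x, y). (Y, x, y) \<in> rlz C Z X \<delta> \<and> Y \<in> S})\<rparr>"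

lemma subcat_simps [simp]:
  "Ob (subcat C S) = S" "Hom (subcat C S) = Hom C" "Id (subcat C S) = Id C"
  "Cmp (subcat C S) = Cmp C" "Ext (subcat C S) = Ext C" "push (subcat C S) = push C"
  "pull (subcat C S) = pull C" "sum_arr (subcat C S) = sum_arr C"
  "sum_ext (subcat C S) = sum_ext C" "ext_morphism (subcat C S) = ext_morphism C"
  by (simp_all add: subcat_def sum_arr_def sum_ext_def ext_morphism_def fun_eq_iff)

lemma realized_by_subcat:
  assumes "S \<subseteq> Ob C"
  shows "realized_by (subcat C S) \<delta> X Y Z x y \<longleftrightarrow>
    realized_by C \<delta> X Y Z x y \<and> X \<in> S \<and> Y \<in> S \<and> Z \<in> S"
  using assms by (auto simp: realized_by_def subcat_def)

lemma conflation_subcat: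
  assumes "S \<subseteq> Ob C"
  shows "conflation (subcat C S) X Y Z x y \<longleftrightarrow> conflation C X Y Z x y \<and> X \<in> S \<and> Y \<in> S \<and> Z \<in> S"
  using assms by (auto simp: conflation_def realized_by_subcat)

lemma biproduct_subcat:
  assumes "S \<subseteq> Ob C"
  shows "biproduct (subcat C S) A B P i j p q \<longleftrightarrow>
    biproduct C A B P i j p q \<and> A \<in> S \<and> B \<in> S \<and> P \<in> S"
  using assms by (auto simp: biproduct_def)

lemma seq_equiv_subcat:
  assumes "S \<subseteq> Ob C"
  shows "((Y, x, y), (Y', x', y')) \<in> seq_equiv (subcat C S) Z X \<longleftrightarrow>
    ((Y, x, y), (Y', x', y')) \<in> seq_equiv C Z X \<and> Y \<in> S \<and> Y' \<in> S"
  using assms by (auto simp: seq_equiv_def seqs_def iso_arr_def)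

theorem subcat_extriangulated:
  assumes "extriangulated_category C" and serre: "serre_subcategory C S"
  shows "extriangulated_category (subcat C S)"
proof -
  interpret extriangulated_category C by fact
  have SO: "S \<subseteq> Ob C"
    using serre by (auto simp: serre_subcategory_def additive_subcategory_def iso_closed_def)
  then have O: "X \<in> S \<Longrightarrow> X \<in> Ob C" for X by auto
  have S_zero: "zero_object C Z \<Longrightarrow> Z \<in> S" for Z
    using serre by (auto simp: serre_subcategory_def additive_subcategory_def)
  have S_bip: "biproduct C A B P i j p q \<Longrightarrow> A \<in> S \<Longrightarrow> B \<in> S \<Longrightarrow> P \<in> S" for A B P i j p q
    using serre unfolding serre_subcategory_def additive_subcategory_def by blast
  have S_ext: "realized_by C \<delta> X Y Z x y \<Longrightarrow> X \<in> S \<Longrightarrow> Z \<in> S \<Longrightarrow> Y \<in> S" for \<delta> X Y Z x y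
    using serre unfolding serre_subcategory_def conflation_def by blast
  note rS = realized_by_subcat[OF SO] and bS = biproduct_subcat[OF SO]
  show ?thesis
  proof (intro extriangulated_category.intro additive_realization.intro additive_bifunctor.intro
      additive_category.intro preadditive_category.intro extriangulated_category_axioms.intro
      additive_realization_axioms.intro additive_bifunctor_axioms.intro
      additive_category_axioms.intro, unfold subcat_simps rS bS)
    show "\<exists>Z. zero_object (subcat C S) Z"
    proof -
      obtain Z where Z: "zero_object C Z" using ex_zero_object by blast
      then have "zero_object (subcat C S) Z"
        using S_zero[OF Z] O by (simp add: zero_object_def)
      then show ?thesis by blast
    qed
    show "\<exists>P i j p q. biproduct C A B P i j p q \<and> A \<in> S \<and> B \<in> S \<and> P \<in> S"
      if "A \<in> S" "B \<in> S" for A B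
      using ex_biproduct[OF O[OF that(1)] O[OF that(2)]] S_bip that by blast
    show "rlz (subcat C S) Z X \<delta> \<in> seqs (subcat C S) Z X // seq_equiv (subcat C S) Z X"
      if Z: "Z \<in> S" and X: "X \<in> S" and \<delta>: "\<delta> \<in> exts C Z X" for Z X \<delta>
    proof -
      obtain Y x y where t: "(Y, x, y) \<in> seqs C Z X" and
        r: "rlz C Z X \<delta> = seq_equiv C Z X `` {(Y, x, y)}"
        using rlz_class[OF O[OF Z] O[OF X] \<delta>] by (auto simp: quotient_def)
      have Y: "Y \<in> Ob C" "x \<in> arr C X Y" "y \<in> arr C Y Z" using t by (auto simp: seqs_def)
      have "iso_arr C Y Y (Id C Y)"
        unfolding iso_arr_def using Y Id_closed Cmp_Id_left by blast
      then have "(Y, x, y) \<in> rlz C Z X \<delta>"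
        using t Cmp_Id_left[of X Y x] Cmp_Id_right[of Y Z y] Y O[OF X] O[OF Z]
        unfolding r by (auto simp: seq_equiv_def)
      then have "Y \<in> S"
        using S_ext[of \<delta> X Y Z x y] X Z Y \<delta> O by (auto simp: realized_by_def)
      have "rlz (subcat C S) Z X \<delta> = {(Y', x', y'). (Y', x', y') \<in> rlz C Z X \<delta> \<and> Y' \<in> S}"
        by (simp add: subcat_def)
      also have "\<dots> = seq_equiv (subcat C S) Z X `` {(Y, x, y)}"
        unfolding r using \<open>Y \<in> S\<close> by (auto simp: seq_equiv_subcat[OF SO])
      finally have "rlz (subcat C S) Z X \<delta> = seq_equiv (subcat C S) Z X `` {(Y, x, y)}" .
      moreover have "(Y, x, y) \<in> seqs (subcat C S) Z X"
        using t \<open>Y \<in> S\<close> by (auto simp: seqs_def)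
      ultimately show ?thesis by (auto simp: quotient_def)
    qed
  next
    fix \<delta> A B D f f' \<delta>' M F g g'
    assume 1: "realized_by C \<delta> A B D f f' \<and> A \<in> S \<and> B \<in> S \<and> D \<in> S"
      and 2: "realized_by C \<delta>' B M F g g' \<and> B \<in> S \<and> M \<in> S \<and> F \<in> S"
    obtain E h h' d e \<delta>'' where E: "h \<in> arr C A M" "h' \<in> arr C M E" "d \<in> arr C D E"
      "e \<in> arr C E F" "\<delta>'' \<in> exts C E A" "h = g \<cdot>\<^bsub>C\<^esub> f" "h' \<cdot>\<^bsub>C\<^esub> g = d \<cdot>\<^bsub>C\<^esub> f'" "e \<cdot>\<^bsub>C\<^esub> h' = g'"
      "realized_by C \<delta>'' A M E h h'" "realized_by C (push C f' \<delta>') D E F d e"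
      "pull C d \<delta>'' = \<delta>" "push C f \<delta>'' = pull C e \<delta>'"
      using ET4[OF conjunct1[OF 1] conjunct1[OF 2]] by blast
    moreover from this have "E \<in> S" using S_ext 1 2 by blast
    ultimately show "\<exists>E \<in> S. \<exists>h \<in> arr C A M. \<exists>h' \<in> arr C M E. \<exists>d \<in> arr C D E. \<exists>e \<in> arr C E F.
      \<exists>\<delta>'' \<in> exts C E A. h = g \<cdot>\<^bsub>C\<^esub> f \<and> h' \<cdot>\<^bsub>C\<^esub> g = d \<cdot>\<^bsub>C\<^esub> f' \<and> e \<cdot>\<^bsub>C\<^esub> h' = g' \<and>
      (realized_by C \<delta>'' A M E h h' \<and> A \<in> S \<and> M \<in> S \<and> E \<in> S) \<and>
      (realized_by C (push C f' \<delta>') D E F d e \<and> D \<in> S \<and> E \<in> S \<and> F \<in> S) \<and>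
      pull C d \<delta>'' = \<delta> \<and> push C f \<delta>'' = pull C e \<delta>'"
      using 1 2 by blast
  next
    fix \<delta> D A B f' f \<delta>' F M g' g
    assume 1: "realized_by C \<delta> D A B f' f \<and> D \<in> S \<and> A \<in> S \<and> B \<in> S"
      and 2: "realized_by C \<delta>' F B M g' g \<and> F \<in> S \<and> B \<in> S \<and> M \<in> S"
    obtain E h' h d e \<delta>'' where E: "h' \<in> arr C E A" "h \<in> arr C A M" "d \<in> arr C D E"
      "e \<in> arr C E F" "\<delta>'' \<in> exts C M E" "h = g \<cdot>\<^bsub>C\<^esub> f" "h' \<cdot>\<^bsub>C\<^esub> d = f'" "f \<cdot>\<^bsub>C\<^esub> h' = g' \<cdot>\<^bsub>C\<^esub> e"
      "realized_by C \<delta>'' E A M h' h" "realized_by C (pull C g' \<delta>) D E F d e"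
      "\<delta>' = push C e \<delta>''" "push C d \<delta> = pull C g \<delta>''"
      using ET4_op[OF conjunct1[OF 1] conjunct1[OF 2]] by blast
    moreover from this have "E \<in> S" using S_ext 1 2 by blast
    ultimately show "\<exists>E \<in> S. \<exists>h' \<in> arr C E A. \<exists>h \<in> arr C A M. \<exists>d \<in> arr C D E. \<exists>e \<in> arr C E F.
      \<exists>\<delta>'' \<in> exts C M E. h = g \<cdot>\<^bsub>C\<^esub> f \<and> h' \<cdot>\<^bsub>C\<^esub> d = f' \<and> f \<cdot>\<^bsub>C\<^esub> h' = g' \<cdot>\<^bsub>C\<^esub> e \<and>
      (realized_by C \<delta>'' E A M h' h \<and> E \<in> S \<and> A \<in> S \<and> M \<in> S) \<and>
      (realized_by C (pull C g' \<delta>) D E F d e \<and> D \<in> S \<and> E \<in> S \<and> F \<in> S) \<and>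
      \<delta>' = push C e \<delta>'' \<and> push C d \<delta> = pull C g \<delta>''"
      using 1 2 by blast
  qed ((blast intro: O Hom_comm_group),
      (blast intro: O Id_closed),
      (blast intro: O Cmp_closed),
      (blast intro: O Cmp_assoc),
      (blast intro: O Cmp_Id_left),
      (blast intro: O Cmp_Id_right),
      (blast intro: O Cmp_additive_left),
      (blast intro: O Cmp_additive_right),
      (blast intro: O Ext_comm_group),
      (blast intro: O push_hom),
      (blast intro: O pull_hom),
      (blast intro: O push_Id),
      (blast intro: O pull_Id),
      (blast intro: O push_Cmp),
      (blast intro: O pull_Cmp),
      (blast intro: O push_pull),
      (blast intro: O push_additive),
      (blast intro: O pull_additive),
      (blast intro: O rlz_morphism),
      (blast intro: O rlz_zero),
      (blast intro: O rlz_sum),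
      (blast intro: O ET3),
      (blast intro: O ET3_op))
qed

record ('o, 'm, 'p, 'n) cat_functor =
  fobj :: "'o \<Rightarrow> 'p"
  fmor :: "'m \<Rightarrow> 'n"

definition inclusion :: "('o, 'm, 'o, 'm) cat_functor"
  where "inclusion = \<lparr>fobj = (\<lambda>X. X), fmor = (\<lambda>f. f)\<rparr>"

section \<open>The Grothendieck monoid\<close>

text \<open>
  The Grothendieck monoid is the quotient of the free commutative monoid on the objects
  (multisets of objects) by the congruence generated by $[X] = [Y]$ for $X \cong Y$, $[0] = 0$ and
  $[Y] = [X] + [Z]$ for each conflation. It is written multiplicatively in the library's notation.
  Its universal property is \<open>groth_universal\<close> below.
\<close>

inductive groth_rel :: "('o, 'm, 'e, 'z) extri_cat_scheme \<Rightarrow> 'o multiset \<Rightarrow> 'o multiset \<Rightarrow> bool"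
  for C
  where
    groth_iso: "isomorphic C X Y \<Longrightarrow> groth_rel C {#X#} {#Y#}"
  | groth_zero: "zero_object C Z \<Longrightarrow> groth_rel C {#Z#} {#}"
  | groth_conflation: "conflation C X Y Z x y \<Longrightarrow> groth_rel C {#Y#} ({#X#} + {#Z#})"
  | groth_refl: "set_mset M \<subseteq> Ob C \<Longrightarrow> groth_rel C M M"
  | groth_sym: "groth_rel C M N \<Longrightarrow> groth_rel C N M"
  | groth_trans: "\<lbrakk>groth_rel C L M; groth_rel C M N\<rbrakk> \<Longrightarrow> groth_rel C L N"
  | groth_add: "\<lbrakk>groth_rel C M N; set_mset K \<subseteq> Ob C\<rbrakk> \<Longrightarrow> groth_rel C (M + K) (N + K)"

definition groth_class :: "('o, 'm, 'e, 'z) extri_cat_scheme \<Rightarrow> 'o multiset \<Rightarrow> 'o multiset set"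
  where "groth_class C M = {N. groth_rel C M N}"

definition groth_monoid :: "('o, 'm, 'e, 'z) extri_cat_scheme \<Rightarrow> 'o multiset set monoid"
  where "groth_monoid C =
    \<lparr>carrier = groth_class C ` {M. set_mset M \<subseteq> Ob C},
     mult = (\<lambda>K L. \<Union>M \<in> K. \<Union>N \<in> L. groth_class C (M + N)),
     one = groth_class C {#}\<rparr>"

abbreviation gcls :: "('o, 'm, 'e, 'z) extri_cat_scheme \<Rightarrow> 'o \<Rightarrow> 'o multiset set"
  where "gcls C X \<equiv> groth_class C {#X#}"

lemma groth_rel_Ob:
  assumes "groth_rel C M N"
  shows "set_mset M \<subseteq> Ob C \<and> set_mset N \<subseteq> Ob C"
  using assms
proof induction
  case (groth_iso X Y)
  then show ?case by (auto simp: isomorphic_def iso_arr_def)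
next
  case (groth_zero Z)
  then show ?case by (auto simp: zero_object_def)
next
  case (groth_conflation X Y Z x y)
  then show ?case by (auto simp: conflation_def realized_by_def)
qed auto

lemma groth_class_eq_iff:
  "set_mset N \<subseteq> Ob C \<Longrightarrow> groth_class C M = groth_class C N \<longleftrightarrow> groth_rel C M N"
  by (auto simp: groth_class_def intro: groth_rel.intros)

lemma groth_rel_add2:
  assumes "groth_rel C M M'" and "groth_rel C N N'"
  shows "groth_rel C (M + N) (M' + N')"
proof -
  have "groth_rel C (M + N) (M' + N)"
    using assms(1) groth_rel_Ob[OF assms(2)] by (auto intro: groth_add)
  moreover have "groth_rel C (N + M') (N' + M')"
    using groth_add[OF assms(2), of M'] groth_rel_Ob[OF assms(1)] by auto
  ultimately show ?thesis
    by (metis add.commute groth_trans)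
qed

lemma groth_mult:
  assumes "set_mset M \<subseteq> Ob C" and "set_mset N \<subseteq> Ob C"
  shows "groth_class C M \<otimes>\<^bsub>groth_monoid C\<^esub> groth_class C N = groth_class C (M + N)"
proof -
  have "groth_class C (M' + N') = groth_class C (M + N)"
    if "M' \<in> groth_class C M" "N' \<in> groth_class C N" for M' N'
  proof -
    have "groth_rel C (M' + N') (M + N)"
      using that by (auto simp: groth_class_def intro: groth_rel_add2 groth_sym)
    then show ?thesis
      using assms by (subst groth_class_eq_iff) auto
  qed
  moreover have "groth_class C M \<noteq> {}" "groth_class C N \<noteq> {}"
    using assms groth_refl unfolding groth_class_def by blast+
  ultimately have "(\<Union>M' \<in> groth_class C M. \<Union>N' \<in> groth_class C N. groth_class C (M' + N'))
    = groth_class C (M + N)"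
    by (intro SUP_eq_const) simp_all
  then show ?thesis
    by (simp add: groth_monoid_def)
qed

lemma groth_carrier_iff:
  "K \<in> carrier (groth_monoid C) \<longleftrightarrow> (\<exists>M. set_mset M \<subseteq> Ob C \<and> K = groth_class C M)"
  by (auto simp: groth_monoid_def)

lemma groth_one: "\<one>\<^bsub>groth_monoid C\<^esub> = groth_class C {#}"
  by (simp add: groth_monoid_def)

lemma groth_comm_monoid: "comm_monoid (groth_monoid C)"
proof (rule comm_monoidI)
  show "\<one>\<^bsub>groth_monoid C\<^esub> \<in> carrier (groth_monoid C)"
    unfolding groth_one groth_carrier_iff by (intro exI[of _ "{#}"]) simp
next
  fix K L assume "K \<in> carrier (groth_monoid C)" "L \<in> carrier (groth_monoid C)"
  then obtain M N where KL: "K = groth_class C M" "set_mset M \<subseteq> Ob C"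
    "L = groth_class C N" "set_mset N \<subseteq> Ob C"
    by (auto simp: groth_carrier_iff)
  show "K \<otimes>\<^bsub>groth_monoid C\<^esub> L \<in> carrier (groth_monoid C)"
    unfolding groth_carrier_iff using KL by (intro exI[of _ "M + N"]) (simp add: groth_mult)
  show "K \<otimes>\<^bsub>groth_monoid C\<^esub> L = L \<otimes>\<^bsub>groth_monoid C\<^esub> K"
    using KL by (simp add: groth_mult add.commute)
  show "\<one>\<^bsub>groth_monoid C\<^esub> \<otimes>\<^bsub>groth_monoid C\<^esub> K = K"
    using KL by (simp add: groth_one groth_mult)
next
  fix J K L assume "J \<in> carrier (groth_monoid C)" "K \<in> carrier (groth_monoid C)"
    "L \<in> carrier (groth_monoid C)"
  then show "J \<otimes>\<^bsub>groth_monoid C\<^esub> K \<otimes>\<^bsub>groth_monoid C\<^esub> L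
    = J \<otimes>\<^bsub>groth_monoid C\<^esub> (K \<otimes>\<^bsub>groth_monoid C\<^esub> L)"
    by (auto simp: groth_carrier_iff groth_mult add.assoc)
qed

text \<open>The library's \<^const>\<open>hom\<close> does not ask for preservation of the unit.\<close>

definition monoid_homs :: "('a, 'c) monoid_scheme \<Rightarrow> ('b, 'd) monoid_scheme \<Rightarrow> ('a \<Rightarrow> 'b) set"
  where "monoid_homs G H = {h \<in> hom G H. h \<one>\<^bsub>G\<^esub> = \<one>\<^bsub>H\<^esub>}"

lemma groth_hom_eqI:
  assumes "h \<in> monoid_homs (groth_monoid C) G" and "h' \<in> monoid_homs (groth_monoid C) G"
    and "\<And>X. X \<in> Ob C \<Longrightarrow> h (gcls C X) = h' (gcls C X)"
    and "K \<in> carrier (groth_monoid C)"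
  shows "h K = h' K"
proof -
  have "set_mset M \<subseteq> Ob C \<Longrightarrow> h (groth_class C M) = h' (groth_class C M)" for M
  proof (induction M)
    case empty
    then show ?case using assms(1,2) by (simp add: monoid_homs_def groth_one)
  next
    case (add X M)
    have eq: "groth_class C (add_mset X M) = gcls C X \<otimes>\<^bsub>groth_monoid C\<^esub> groth_class C M"
      using add.prems by (simp add: groth_mult)
    have mem: "gcls C X \<in> carrier (groth_monoid C)" "groth_class C M \<in> carrier (groth_monoid C)"
      using add.prems by (auto simp: groth_monoid_def)
    show ?case
      using assms(1-3) add mem unfolding eq by (auto simp: monoid_homs_def hom_def)
  qed
  then show ?thesis using assms(4) by (auto simp: groth_carrier_iff)
qed

theorem groth_universal:
  fixes G (structure)
  assumes G: "comm_monoid G" and f: "f \<in> Ob C \<rightarrow> carrier G"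
    and f_iso: "\<And>X Y. isomorphic C X Y \<Longrightarrow> f X = f Y"
    and f_zero: "\<And>Z. zero_object C Z \<Longrightarrow> f Z = \<one>"
    and f_conflation: "\<And>X Y Z x y. conflation C X Y Z x y \<Longrightarrow> f Y = f X \<otimes> f Z"
  shows "\<exists>!h. h \<in> monoid_homs (groth_monoid C) G \<and> h \<in> extensional (carrier (groth_monoid C)) \<and>
    (\<forall>X \<in> Ob C. h (gcls C X) = f X)"
proof -
  interpret comm_monoid G by (rule G)
  define step where "step X a = (if X \<in> Ob C \<and> a \<in> carrier G then f X \<otimes> a else a)" for X a
  have fc: "X \<in> Ob C \<Longrightarrow> f X \<in> carrier G" for X using f by auto
  interpret st: comp_fun_commute step
    by unfold_locales (auto simp: step_def fun_eq_iff fc m_lcomm)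
  define ev where "ev M = fold_mset step \<one> M" for M
  have ev_empty: "ev {#} = \<one>" by (simp add: ev_def)
  have ev_closed: "ev M \<in> carrier G" for M
    by (induction M) (auto simp: ev_def step_def fc)
  have ev_add_mset: "X \<in> Ob C \<Longrightarrow> ev (add_mset X M) = f X \<otimes> ev M" for X M
    using ev_closed[of M] by (simp add: ev_def step_def)
  have ev_plus: "set_mset M \<subseteq> Ob C \<Longrightarrow> ev (M + N) = ev M \<otimes> ev N" for M N
    by (induction M) (auto simp: ev_empty ev_closed ev_add_mset fc m_assoc)
  have ev_rel: "groth_rel C M N \<Longrightarrow> ev M = ev N" for M N
  proof (induction rule: groth_rel.induct)
    case (groth_iso X Y)
    then show ?case using f_iso[of X Y]
      by (auto simp: ev_add_mset ev_empty isomorphic_def iso_arr_def)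
  next
    case (groth_zero Z)
    then show ?case using f_zero[of Z] by (auto simp: ev_add_mset ev_empty zero_object_def)
  next
    case (groth_conflation X Y Z x y)
    then have "X \<in> Ob C" "Y \<in> Ob C" "Z \<in> Ob C"
      by (auto simp: conflation_def realized_by_def)
    then show ?case using f_conflation[OF groth_conflation] by (simp add: ev_add_mset ev_empty fc m_comm)
  next
    case (groth_add M N K)
    then show ?case using groth_rel_Ob[OF groth_add(1)] by (simp add: ev_plus)
  qed auto
  define h where "h = (\<lambda>K \<in> carrier (groth_monoid C). THE a. \<exists>M \<in> K. a = ev M)"
  have h_class: "h (groth_class C M) = ev M" if M: "set_mset M \<subseteq> Ob C" for M
  proof -
    have "(THE a. \<exists>N \<in> groth_class C M. a = ev N) = ev M"
      using M ev_rel by (intro the_equality) (auto simp: groth_class_def intro: groth_refl)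
    then show ?thesis using M by (auto simp: h_def groth_monoid_def)
  qed
  have h_hom: "h \<in> monoid_homs (groth_monoid C) G"
    by (auto simp: monoid_homs_def hom_def groth_one groth_carrier_iff groth_mult h_class ev_closed
        ev_empty ev_plus)
  have h_ext: "h \<in> extensional (carrier (groth_monoid C))" by (simp add: h_def)
  have h_gcls: "h (gcls C X) = f X" if "X \<in> Ob C" for X
    using that by (simp add: h_class ev_add_mset ev_empty fc)
  have "h' = h"
    if h': "h' \<in> monoid_homs (groth_monoid C) G \<and> h' \<in> extensional (carrier (groth_monoid C)) \<and>
      (\<forall>X \<in> Ob C. h' (gcls C X) = f X)" for h'
  proof (rule extensionalityI)
    show "h' \<in> extensional (carrier (groth_monoid C))" using h' by blast
    show "h' K = h K" if "K \<in> carrier (groth_monoid C)" for K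
    proof (rule groth_hom_eqI[OF _ h_hom _ that])
      show "h' \<in> monoid_homs (groth_monoid C) G" using h' by blast
      show "h' (gcls C X) = h (gcls C X)" if "X \<in> Ob C" for X
        using h' h_gcls[OF that] that by metis
    qed
  qed (rule h_ext)
  then show ?thesis using h_hom h_ext h_gcls by (intro ex1I[of _ h]) blast+
qed

text \<open>
  The homomorphism $\mathsf{M}(F)$ induced by a functor $F$ into \<open>D\<close> which preserves conflations,
  $[X] \mapsto [FX]$. It is characterised by \<open>groth_map_hom\<close> below.
\<close>

definition groth_map ::
    "('p, 'n, 'e, 'z) extri_cat_scheme \<Rightarrow> ('o, 'm, 'p, 'n) cat_functor \<Rightarrow> 'o multiset set \<Rightarrow> 'p multiset set"
  where "groth_map D F K = (\<Union>M \<in> K. groth_class D (image_mset (fobj F) M))"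

lemma groth_map_class:
  assumes M: "set_mset M \<subseteq> Ob C"
    and Ob: "\<And>X. X \<in> Ob C \<Longrightarrow> fobj F X \<in> Ob D"
    and iso: "\<And>X Y. isomorphic C X Y \<Longrightarrow> isomorphic D (fobj F X) (fobj F Y)"
    and zero: "\<And>Z. zero_object C Z \<Longrightarrow> zero_object D (fobj F Z)"
    and conf: "\<And>X Y Z x y. conflation C X Y Z x y
      \<Longrightarrow> conflation D (fobj F X) (fobj F Y) (fobj F Z) (fmor F x) (fmor F y)"
  shows "groth_map D F (groth_class C M) = groth_class D (image_mset (fobj F) M)"
proof -
  have rel: "groth_rel C M N \<Longrightarrow> groth_rel D (image_mset (fobj F) M) (image_mset (fobj F) N)" for M N
  proof (induction rule: groth_rel.induct)
    case (groth_conflation X Y Z x y)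
    then show ?case using groth_rel.groth_conflation[OF conf] by simp
  next
    case (groth_trans L M N)
    then show ?case by (blast intro: groth_rel.groth_trans)
  next
    case (groth_sym M N)
    then show ?case by (blast intro: groth_rel.groth_sym)
  qed (auto intro!: groth_rel.groth_iso groth_rel.groth_zero groth_rel.groth_refl
      groth_rel.groth_add iso zero Ob)
  have "groth_class D (image_mset (fobj F) N) = groth_class D (image_mset (fobj F) M)"
    if "N \<in> groth_class C M" for N
    using groth_sym[OF rel[of M N]] that M Ob
    by (subst groth_class_eq_iff) (auto simp: groth_class_def)
  moreover have "groth_class C M \<noteq> {}"
    using groth_refl[OF M] by (auto simp: groth_class_def)
  ultimately show ?thesis unfolding groth_map_def by (rule SUP_eq_const[rotated])
qed

theorem groth_map_hom:
  assumes "\<And>X. X \<in> Ob C \<Longrightarrow> fobj F X \<in> Ob D"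
    and "\<And>X Y. isomorphic C X Y \<Longrightarrow> isomorphic D (fobj F X) (fobj F Y)"
    and "\<And>Z. zero_object C Z \<Longrightarrow> zero_object D (fobj F Z)"
    and "\<And>X Y Z x y. conflation C X Y Z x y
      \<Longrightarrow> conflation D (fobj F X) (fobj F Y) (fobj F Z) (fmor F x) (fmor F y)"
  shows "groth_map D F \<in> monoid_homs (groth_monoid C) (groth_monoid D)"
    and "X \<in> Ob C \<Longrightarrow> groth_map D F (gcls C X) = gcls D (fobj F X)"
proof -
  note cls = groth_map_class[OF _ assms]
  have Ob: "set_mset (image_mset (fobj F) M) \<subseteq> Ob D" if "set_mset M \<subseteq> Ob C" for M
    using that assms(1) by auto
  have closed: "\<exists>N. set_mset N \<subseteq> Ob D \<and> groth_class D (image_mset (fobj F) M) = groth_class D N"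
    if "set_mset M \<subseteq> Ob C" for M
    using Ob[OF that] by blast
  show "groth_map D F \<in> monoid_homs (groth_monoid C) (groth_monoid D)"
    unfolding monoid_homs_def hom_def
  proof (intro CollectI conjI Pi_I ballI)
    fix K assume "K \<in> carrier (groth_monoid C)"
    then show "groth_map D F K \<in> carrier (groth_monoid D)"
      using closed by (auto simp: groth_carrier_iff cls)
  next
    fix K L assume "K \<in> carrier (groth_monoid C)" "L \<in> carrier (groth_monoid C)"
    then obtain M N where "K = groth_class C M" "set_mset M \<subseteq> Ob C"
      "L = groth_class C N" "set_mset N \<subseteq> Ob C"
      by (auto simp: groth_carrier_iff)
    then show "groth_map D F (K \<otimes>\<^bsub>groth_monoid C\<^esub> L)
      = groth_map D F K \<otimes>\<^bsub>groth_monoid D\<^esub> groth_map D F L"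
      using Ob[of M] Ob[of N] by (simp add: groth_mult cls)
  qed (simp add: groth_one cls)
  show "groth_map D F (gcls C X) = gcls D (fobj F X)" if "X \<in> Ob C"
    using that by (simp add: cls)
qed

definition groth_image :: "('o, 'm, 'e, 'z) extri_cat_scheme \<Rightarrow> 'o set \<Rightarrow> 'o multiset set set"
  where "groth_image C S = {gcls C X | X. X \<in> S}"

end

theory Submission
  imports Defs
begin

text \<open>
  By the Serre property, each generating relation of the congruence defining $\mathsf{M}(\mathcal{C})$
  has all of its objects in $\mathcal{S}$ as soon as one of its two sides does, and it is then a
  relation for $\mathsf{M}(\mathcal{S})$. So a chain of relations in $\mathcal{C}$ that starts at
  objects of $\mathcal{S}$ never leaves $\mathcal{S}$, which gives injectivity.
\<close>

text \<open>The split sequence of a biproduct realizes the zero extension.\<close>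

lemma (in extriangulated_category) conflation_biproduct:
  assumes "biproduct C X Z P i j p q"
  shows "conflation C X P Z i q"
  using rlz_zero[OF assms] unfolding conflation_def by blast

text \<open>A zero object represents the empty multiset, and a biproduct represents a sum of two
  objects because its split sequence is a conflation. Induction on the multiset combines the
  two.\<close>

lemma (in extriangulated_category) groth_class_eq_gcls:
  assumes "set_mset M \<subseteq> Ob C"
  shows "\<exists>X \<in> Ob C. groth_class C M = gcls C X"
proof -
  have "\<exists>X \<in> Ob C. groth_rel C M {#X#}"
    using assms
  proof (induction M)
    case empty
    obtain Z where "zero_object C Z" using ex_zero_object by blast
    then show ?case
      using groth_sym[OF groth_zero, of C Z] by (auto simp: zero_object_def)
  next
    case (add Y M)
    then obtain X where X: "X \<in> Ob C" "groth_rel C M {#X#}" and Y: "Y \<in> Ob C"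
      by auto
    then obtain P i j p q where P: "biproduct C X Y P i j p q"
      using ex_biproduct by blast
    \<comment> \<open>First \<open>M\<close> is replaced by its representing object
      \<open>X\<close>; then \<open>X\<close> and \<open>Y\<close> are merged into their biproduct
      \<open>P\<close>.\<close>
    have "groth_rel C (M + {#Y#}) ({#X#} + {#Y#})"
      using X Y by (intro groth_add) auto
    moreover have "groth_rel C ({#X#} + {#Y#}) {#P#}"
      using groth_sym[OF groth_conflation[OF conflation_biproduct[OF P]]] .
    ultimately have "groth_rel C (add_mset Y M) {#P#}"
      by (metis groth_trans add_mset_add_single)
    then show ?case
      using P by (auto simp: biproduct_def)
  qed
  then show ?thesis
    by (metis groth_class_eq_iff groth_rel_Ob)
qed

lemma (in extriangulated_category) groth_carrier_eq_image:
  "carrier (groth_monoid C) = gcls C ` Ob C"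
proof (intro equalityI subsetI)
  fix K assume "K \<in> carrier (groth_monoid C)"
  then show "K \<in> gcls C ` Ob C"
    unfolding groth_carrier_iff using groth_class_eq_gcls by blast
next
  fix K assume "K \<in> gcls C ` Ob C"
  then obtain X where "X \<in> Ob C" "K = gcls C X"
    by blast
  then show "K \<in> carrier (groth_monoid C)"
    unfolding groth_carrier_iff by (intro exI[of _ "{#X#}"]) simp
qed

text \<open>Since the identity of \<open>Z\<close> factors through \<open>Z0\<close>, so does every
  morphism into or out of \<open>Z\<close>, and its part at \<open>Z0\<close> is forced.\<close>

lemma (in preadditive_category) zero_objectI_factor:
  assumes Z0: "zero_object C Z0" and Z: "Z \<in> Ob C"
    and f: "f \<in> arr C Z Z0" and g: "g \<in> arr C Z0 Z" and gf: "g \<cdot> f = Id C Z"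
  shows "zero_object C Z"
proof -
  have O: "Z0 \<in> Ob C" using Z0 by (simp add: zero_object_def)
  have "(\<exists>!h. h \<in> arr C A Z) \<and> (\<exists>!h. h \<in> arr C Z A)" if A: "A \<in> Ob C" for A
  proof
    obtain a where a: "a \<in> arr C A Z0" "\<And>b. b \<in> arr C A Z0 \<Longrightarrow> b = a"
      using Z0 A unfolding zero_object_def by metis
    have "h = g \<cdot> a" if h: "h \<in> arr C A Z" for h
      using Cmp_assoc[OF A Z O Z h f g] Cmp_Id_left[OF A Z h] gf
        a(2)[OF Cmp_closed[OF A Z O h f]] by simp
    then show "\<exists>!h. h \<in> arr C A Z"
      using Cmp_closed[OF A O Z a(1) g] by blast
    obtain b where b: "b \<in> arr C Z0 A" "\<And>c. c \<in> arr C Z0 A \<Longrightarrow> c = b"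
      using Z0 A unfolding zero_object_def by metis
    have "h = b \<cdot> f" if h: "h \<in> arr C Z A" for h
      using Cmp_assoc[OF Z O Z A f g h] Cmp_Id_right[OF Z A h] gf
        b(2)[OF Cmp_closed[OF O Z A g h]] by simp
    then show "\<exists>!h. h \<in> arr C Z A"
      using Cmp_closed[OF Z O A f b(1)] by blast
  qed
  then show ?thesis using Z by (simp add: zero_object_def)
qed

text \<open>Fullness keeps the inverse morphism in the subcategory.\<close>

lemma isomorphic_subcat:
  assumes "S \<subseteq> Ob C"
  shows "isomorphic (subcat C S) X Y \<longleftrightarrow> isomorphic C X Y \<and> X \<in> S \<and> Y \<in> S"
  using assms by (auto simp: isomorphic_def iso_arr_def)

lemma isomorphic_sym: "isomorphic C X Y \<Longrightarrow> isomorphic C Y X"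
  unfolding isomorphic_def iso_arr_def by blast

context
  fixes C :: "('o, 'm, 'e) extri_cat" and S :: "'o set"
  assumes extri: "extriangulated_category C" and serre: "serre_subcategory C S"
begin

interpretation extriangulated_category C by (rule extri)

lemma serre_subset: "S \<subseteq> Ob C"
  using serre by (auto simp: serre_subcategory_def additive_subcategory_def iso_closed_def)

lemma serre_iso: "isomorphic C X Y \<Longrightarrow> X \<in> S \<longleftrightarrow> Y \<in> S"
  using serre isomorphic_sym[of C]
  unfolding serre_subcategory_def additive_subcategory_def iso_closed_def by blast

lemma serre_zero: "zero_object C Z \<Longrightarrow> Z \<in> S"
  using serre by (auto simp: serre_subcategory_def additive_subcategory_def)

lemma serre_conflation: "conflation C X Y Z x y \<Longrightarrow> Y \<in> S \<longleftrightarrow> X \<in> S \<and> Z \<in> S"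
  using serre unfolding serre_subcategory_def by blast

text \<open>The delicate direction is from \<open>subcat C S\<close> to \<open>C\<close>: there the
  universal property is given only against objects of \<open>S\<close>. It suffices, because
  \<open>S\<close> contains a zero object of \<open>C\<close>, through which the identity of
  \<open>Z\<close> factors.\<close>

lemma zero_object_subcat: "zero_object (subcat C S) Z \<longleftrightarrow> zero_object C Z"
proof
  assume Z: "zero_object C Z"
  have "A \<in> Ob C" if "A \<in> S" for A
    using that serre_subset by blast
  then show "zero_object (subcat C S) Z"
    using Z serre_zero[OF Z] by (simp add: zero_object_def)
next
  assume Z: "zero_object (subcat C S) Z"
  obtain Z0 where Z0: "zero_object C Z0" using ex_zero_object by blast
  have S: "Z \<in> S" "Z0 \<in> S" and O: "Z \<in> Ob C" "Z0 \<in> Ob C"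
    using Z serre_zero[OF Z0] serre_subset by (auto simp: zero_object_def)
  obtain f g where f: "f \<in> arr C Z Z0" and g: "g \<in> arr C Z0 Z"
    using Z0 O unfolding zero_object_def by blast
  \<comment> \<open>Testing \<open>Z\<close> against itself inside \<open>S\<close> shows that it
    has only one endomorphism; fullness makes this a statement about \<open>C\<close>.\<close>
  have "\<exists>!h. h \<in> arr C Z Z"
    using Z S by (auto simp: zero_object_def)
  then have "g \<cdot>\<^bsub>C\<^esub> f = Id C Z"
    using Cmp_closed[OF O(1) O(2) O(1) f g] Id_closed[OF O(1)] by blast
  then show "zero_object C Z"
    using zero_objectI_factor[OF Z0 O(1) f g] by blast
qed

text \<open>The equivalence is carried through the induction together with the relation:
  transitivity needs the middle multiset to lie in \<open>S\<close>, and symmetry needs membership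
  to pass from right to left.\<close>

lemma groth_rel_serre:
  assumes "groth_rel C M N"
  shows "(set_mset M \<subseteq> S \<longleftrightarrow> set_mset N \<subseteq> S) \<and> (set_mset M \<subseteq> S \<longrightarrow> groth_rel (subcat C S) M N)"
  using assms
proof induction
  case (groth_iso X Y)
  then show ?case
    using serre_iso[of X Y]
    by (auto intro!: groth_rel.groth_iso simp: isomorphic_subcat[OF serre_subset])
next
  case (groth_zero Z)
  then show ?case
    by (auto intro!: groth_rel.groth_zero simp: zero_object_subcat serre_zero)
next
  case (groth_conflation X Y Z x y)
  \<comment> \<open>Closure under subobjects and quotients puts \<open>X\<close> and
    \<open>Z\<close> in \<open>S\<close>; closure under extensions gives the converse half of the
    equivalence.\<close>
  have "conflation (subcat C S) X Y Z x y" if "Y \<in> S"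
    using that groth_conflation serre_conflation by (simp add: conflation_subcat[OF serre_subset])
  then show ?case
    using serre_conflation[OF groth_conflation] groth_rel.groth_conflation[of "subcat C S"]
    by auto
next
  case (groth_refl M)
  then show ?case by (auto intro!: groth_rel.groth_refl)
next
  case (groth_sym M N)
  then show ?case by (blast intro: groth_rel.groth_sym)
next
  case (groth_trans L M N)
  then show ?case by (blast intro: groth_rel.groth_trans)
next
  case (groth_add M N K)
  then show ?case by (auto intro!: groth_rel.groth_add)
qed

text \<open>These are the hypotheses of \<open>groth_map_class\<close> and
  \<open>groth_map_hom\<close> for the inclusion. The clause on zero objects rests on
  \<open>zero_object_subcat\<close>.\<close>

lemma inclusion_preserves:
  shows "X \<in> Ob (subcat C S) \<Longrightarrow> fobj inclusion X \<in> Ob C"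
    and "isomorphic (subcat C S) X Y \<Longrightarrow> isomorphic C (fobj inclusion X) (fobj inclusion Y)"
    and "zero_object (subcat C S) Z \<Longrightarrow> zero_object C (fobj inclusion Z)"
    and "conflation (subcat C S) X Y Z x y \<Longrightarrow>
      conflation C (fobj inclusion X) (fobj inclusion Y) (fobj inclusion Z)
        (fmor inclusion x) (fmor inclusion y)"
  using serre_subset
  by (auto simp: inclusion_def isomorphic_subcat zero_object_subcat conflation_subcat)

lemma groth_map_inclusion_class:
  assumes "set_mset M \<subseteq> S"
  shows "groth_map C inclusion (groth_class (subcat C S) M) = groth_class C M"
proof -
  have "groth_map C inclusion (groth_class (subcat C S) M)
      = groth_class C (image_mset (fobj (inclusion :: ('o, 'm, 'o, 'm) cat_functor)) M)"
    by (rule groth_map_class[OF _ inclusion_preserves]) (use assms in simp_all)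
  then show ?thesis by (simp add: inclusion_def)
qed

lemma groth_map_inclusion_hom:
  "groth_map C inclusion \<in> monoid_homs (groth_monoid (subcat C S)) (groth_monoid C)"
  by (rule groth_map_hom(1)[OF inclusion_preserves])

lemma groth_map_inclusion_inj:
  "inj_on (groth_map C inclusion) (carrier (groth_monoid (subcat C S)))"
proof (rule inj_onI)
  fix K L
  assume "K \<in> carrier (groth_monoid (subcat C S))" "L \<in> carrier (groth_monoid (subcat C S))"
  then obtain M N where M: "set_mset M \<subseteq> S" "K = groth_class (subcat C S) M"
    and N: "set_mset N \<subseteq> S" "L = groth_class (subcat C S) N"
    by (auto simp: groth_carrier_iff)
  assume "groth_map C inclusion K = groth_map C inclusion L"
  then have "groth_class C M = groth_class C N"
    using M N by (simp add: groth_map_inclusion_class)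
  then have "groth_rel C M N"
    using N serre_subset groth_class_eq_iff[of N C M] by blast
  \<comment> \<open>As \<open>M\<close> lies over \<open>S\<close>, the relation in \<open>C\<close>
    descends to one in \<open>subcat C S\<close>.\<close>
  then show "K = L"
    using M N groth_rel_serre by (simp add: groth_class_eq_iff)
qed

text \<open>\<open>groth_image\<close> collects classes of single objects only. These exhaust the
  monoid of \<open>subcat C S\<close>, because a Serre subcategory is itself extriangulated and so
  has biproducts to represent sums.\<close>

lemma groth_map_inclusion_image:
  "groth_map C inclusion ` carrier (groth_monoid (subcat C S)) = groth_image C S"
proof -
  interpret S: extriangulated_category "subcat C S"
    by (rule subcat_extriangulated[OF extri serre])
  show ?thesis
    by (auto simp: S.groth_carrier_eq_image image_image groth_map_inclusion_class groth_image_def)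
qed

end

lemma submonoid_monoid_homs_image:
  assumes "monoid G" and "monoid H" and "h \<in> monoid_homs G H"
  shows "submonoid (h ` carrier G) H"
proof
  show "h ` carrier G \<subseteq> carrier H"
    using assms by (auto simp: monoid_homs_def hom_def)
  \<comment> \<open>This uses the preservation of the unit that \<open>monoid_homs\<close> adds to
    \<open>hom\<close>.\<close>
  show "\<one>\<^bsub>H\<^esub> \<in> h ` carrier G"
    using assms monoid.one_closed[OF assms(1)] by (auto simp: monoid_homs_def intro: rev_image_eqI)
  fix a b assume "a \<in> h ` carrier G" "b \<in> h ` carrier G"
  then obtain x y where "x \<in> carrier G" "a = h x" "y \<in> carrier G" "b = h y"
    by blast
  then have "a \<otimes>\<^bsub>H\<^esub> b = h (x \<otimes>\<^bsub>G\<^esub> y)" "x \<otimes>\<^bsub>G\<^esub> y \<in> carrier G"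
    using assms monoid.m_closed[OF assms(1)] by (auto simp: monoid_homs_def hom_def)
  then show "a \<otimes>\<^bsub>H\<^esub> b \<in> h ` carrier G"
    by simp
qed

theorem proposition3p7:
  fixes C :: "('o, 'm, 'e) extri_cat" and S :: "'o set"
  assumes "extriangulated_category C"
    and "serre_subcategory C S"
  shows
   "(groth_map C inclusion \<in> monoid_homs (groth_monoid (subcat C S)) (groth_monoid C)) \<and>
    (\<forall>X \<in> S. groth_map C inclusion (gcls (subcat C S) X) = gcls C X) \<and>
    (inj_on (groth_map C inclusion) (carrier (groth_monoid (subcat C S)))) \<and>
    (submonoid (groth_image C S) (groth_monoid C)) \<and>
    (groth_map C inclusion
      \<in> iso (groth_monoid (subcat C S)) (groth_monoid C\<lparr>carrier := groth_image C S\<rparr>))"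
proof -
  note h = groth_map_inclusion_hom[OF assms] and inj = groth_map_inclusion_inj[OF assms]
    and img = groth_map_inclusion_image[OF assms]
  have "submonoid (groth_image C S) (groth_monoid C)"
    using submonoid_monoid_homs_image[OF _ _ h] comm_monoid.axioms(1)[OF groth_comm_monoid] img
    by metis
  \<comment> \<open>Restricting the carrier keeps the operation, so the map stays a homomorphism
    onto its image, and injectivity makes it bijective.\<close>
  moreover have "groth_map C inclusion
      \<in> iso (groth_monoid (subcat C S)) (groth_monoid C\<lparr>carrier := groth_image C S\<rparr>)"
    using h inj img by (auto simp: iso_def bij_betw_def hom_def monoid_homs_def)
  ultimately show ?thesis
    using h inj groth_map_inclusion_class[OF assms] by simp
qed

end
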